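(* The graph $\mathbb C_3$ is a model-complete core, i.e., for every finite $F\subseteq V(\mathbb C_3)$ and every endomorphism $e$ of $\mathbb C_3$ there exists an automorphism $a$ of $\mathbb C_3$ such that $e|_F=a|_F$.
   Context: $\mathbb C_3$ is the graph whose vertex set is a countable dense subset of the unit circle $S^1$ such that any two distinct points of it lie at a rational angle (in radians, hence never exactly $2\pi/3$), and $xy$ is an edge iff both circular arcs with end-points $x,y$ have length strictly larger than $1/3$ of the circumference (any such choice gives the same graph up to isomorphism). An endomorphism is an edge-preserving map $V(\mathbb C_3)\to V(\mathbb C_3)$. *)

theory Defs
  imports "HOL-Analysis.Analysis"
begin

section \<open>Graphs, endomorphisms and automorphisms\<close>

text \<open>A graph is given by a vertex set \<open>V\<close> and an adjacency relation \<open>E\<close>, of which only the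
  restriction to \<open>V\<close> matters. Likewise maps are relevant only on \<open>V\<close>.\<close>

definition graph_endomorphism :: "'a set \<Rightarrow> ('a \<Rightarrow> 'a \<Rightarrow> bool) \<Rightarrow> ('a \<Rightarrow> 'a) \<Rightarrow> bool" where
  "graph_endomorphism V E e \<longleftrightarrow>
     e \<in> V \<rightarrow> V \<and> (\<forall>x\<in>V. \<forall>y\<in>V. E x y \<longrightarrow> E (e x) (e y))"

definition graph_automorphism :: "'a set \<Rightarrow> ('a \<Rightarrow> 'a \<Rightarrow> bool) \<Rightarrow> ('a \<Rightarrow> 'a) \<Rightarrow> bool" where
  "graph_automorphism V E a \<longleftrightarrow>
     bij_betw a V V \<and> (\<forall>x\<in>V. \<forall>y\<in>V. E x y \<longleftrightarrow> E (a x) (a y))"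

definition model_complete_core :: "'a set \<Rightarrow> ('a \<Rightarrow> 'a \<Rightarrow> bool) \<Rightarrow> bool" where
  "model_complete_core V E \<longleftrightarrow>
     (\<forall>F e. finite F \<and> F \<subseteq> V \<and> graph_endomorphism V E e \<longrightarrow>
        (\<exists>a. graph_automorphism V E a \<and> (\<forall>x\<in>F. e x = a x)))"

section \<open>The graph $\mathbb{C}_3$\<close>

text \<open>Angles are taken modulo \<open>2 * pi\<close>: two points lie at a rational angle if some rotation by a
  rational number of radians takes one to the other. (With the unsigned angle in \<open>{0..pi}\<close> instead,
  no dense set would qualify: three points not contained in a closed half circle would have
  pairwise angles that sum to \<open>2 * pi\<close>.)\<close>

definition rational_angle :: "complex \<Rightarrow> complex \<Rightarrow> bool" where
  "rational_angle x y \<longleftrightarrow> (\<exists>r\<in>\<rat>. y = cis r * x)"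

definition C3_vertex_set :: "complex set \<Rightarrow> bool" where
  "C3_vertex_set V \<longleftrightarrow>
     countable V \<and> V \<subseteq> sphere 0 1 \<and> sphere 0 1 \<subseteq> closure V \<and>
     (\<forall>x\<in>V. \<forall>y\<in>V. x \<noteq> y \<longrightarrow> rational_angle x y)"

text \<open>On the unit circle, \<open>Arg2pi (y / x)\<close> is the length of the arc from \<open>x\<close> counterclockwise
  to \<open>y\<close>; the other arc with these end-points runs counterclockwise from \<open>y\<close> to \<open>x\<close>.
  For \<open>x = y\<close> both values are \<open>0\<close>, so there are no loops.\<close>

definition arc_length :: "complex \<Rightarrow> complex \<Rightarrow> real" where
  "arc_length x y = Arg2pi (y / x)"

definition C3_edge :: "complex \<Rightarrow> complex \<Rightarrow> bool" where
  "C3_edge x y \<longleftrightarrow> arc_length x y > (2 * pi) / 3 \<and> arc_length y x > (2 * pi) / 3"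

end

theory Submission
  imports Defs
begin

text \<open>
  The graph is triangle-free, and any two vertices less than a third of the circle apart have a
  common neighbour. Hence non-adjacency means having a common neighbour, which is preserved by
  endomorphisms just as edges are; since vertices are also separated by their neighbourhoods, every
  endomorphism is an embedding (\<open>endomorphism_embedding\<close>).

  Next fix a vertex \<open>b\<close>, cut the circle into thirds beginning at \<open>b\<close>, and turn the thirds on top of
  each other. As \<open>pi\<close> is irrational, no two distinct vertices are a multiple of a third of the
  circle apart, so the vertices other than \<open>b\<close> become distinct points of an open interval, in which
  each third, taken as a colour, is dense. Adjacency with \<open>b\<close> marks the middle third, and adjacency between other
  vertices is determined by the colours and the order (\<open>C3_sector_chart\<close>).

  Conversely, an embedding \<open>e\<close> cannot help respecting this coloured order, up to a reflection of the
  circle. A vertex in an outer third cuts the neighbours of \<open>b\<close> in two, and from the images of the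
  pieces one sees whether its third is kept or exchanged for the other outer one. The same must happen
  for all vertices (\<open>sec_kept\<close>), and after a reflection of the chart at \<open>e b\<close> if necessary, \<open>e\<close>
  preserves all colours and then also the order, because vertices of different thirds interleave
  densely (\<open>pos_mono_if_sec_kept\<close>).

  So the restriction of \<open>e\<close> to a finite set is a finite partial isomorphism between two countable
  dense orders with three dense colours. It extends to an isomorphism by Cantor's back-and-forth
  argument (\<open>back_and_forth\<close>), and this is an automorphism of the graph that sends \<open>b\<close> to \<open>e b\<close>.
\<close>

section \<open>The irrationality of \<open>pi\<close>\<close>

text \<open>Integrating these functions against the sine over \<open>{0..pi}\<close> gives numbers that satisfy a linear
  recurrence with coefficients in \<open>\<int>[pi\<^sup>2]\<close>. They decay faster than any geometric sequence, so that if
  \<open>pi = p / q\<close>, their multiples by \<open>q ^ n\<close> are integers that tend to \<open>0\<close>.\<close>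

definition niven :: "nat \<Rightarrow> real \<Rightarrow> real" where
  "niven n x = (x * (pi - x)) ^ n / fact n"

definition niven_integral :: "nat \<Rightarrow> real" where
  "niven_integral n = integral {0..pi} (\<lambda>x. niven n x * sin x)"

lemma niven_has_integral:
  "((\<lambda>x. niven n x * sin x) has_integral niven_integral n) {0..pi}"
  unfolding niven_integral_def niven_def
  by (intro integrable_integral integrable_continuous_interval continuous_intros) auto

lemma niven_deriv:
  "(niven (Suc n) has_real_derivative (pi - 2 * x) * niven n x) (at x within S)"
proof -
  have "((\<lambda>x. x * (pi - x)) has_real_derivative (pi - 2 * x)) (at x within S)"
    by (auto intro!: derivative_eq_intros)
  from DERIV_cdivide[OF DERIV_power[OF this, of "Suc n"]]
  have "((\<lambda>x. (x * (pi - x)) ^ Suc n / fact (Suc n)) has_real_derivative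
      (real (Suc n) * (x * (pi - x)) ^ n * (pi - 2 * x)) / fact (Suc n)) (at x within S)"
    by (simp add: mult_ac del: of_nat_Suc fact_Suc power_Suc)
  also have "(real (Suc n) * (x * (pi - x)) ^ n * (pi - 2 * x)) / fact (Suc n)
      = (pi - 2 * x) * niven n x"
    by (simp add: niven_def divide_simps del: of_nat_Suc)
  finally show ?thesis
    by (simp add: niven_def[abs_def])
qed

lemma niven_Suc: "x * (pi - x) * niven n x = real (Suc n) * niven (Suc n) x"
  by (simp add: niven_def divide_simps del: of_nat_Suc)

lemma niven_integral_0: "niven_integral 0 = 2"
proof -
  have "((\<lambda>x. sin x) has_integral (- cos pi - (- cos 0))) {0..pi}"
    by (rule fundamental_theorem_of_calculus)
       (auto intro!: derivative_eq_intros simp flip: has_real_derivative_iff_has_vector_derivative)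
  then show ?thesis
    by (simp add: niven_integral_def niven_def integral_unique)
qed

lemma niven_integral_1: "niven_integral 1 = 4"
proof -
  let ?F = "\<lambda>x. (pi - 2 * x) * sin x - niven 1 x * cos x"
  have d: "(?F has_real_derivative (niven 1 x * sin x - 2 * (niven 0 x * sin x))) (at x within {0..pi})" for x
  proof -
    have [derivative_intros]: "(niven (Suc 0) has_real_derivative (pi - 2 * x)) (at x within {0..pi})"
      using niven_deriv[of 0 x] by (simp add: niven_def)
    show ?thesis
      by (auto intro!: derivative_eq_intros simp: niven_def[of 0] algebra_simps)
  qed
  have "((\<lambda>x. niven 1 x * sin x - 2 * (niven 0 x * sin x)) has_integral ?F pi - ?F 0) {0..pi}"
    by (rule fundamental_theorem_of_calculus)
       (use d in \<open>auto simp flip: has_real_derivative_iff_has_vector_derivative\<close>)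
  moreover have "((\<lambda>x. niven 1 x * sin x - 2 * (niven 0 x * sin x)) has_integral
      niven_integral 1 - 2 * niven_integral 0) {0..pi}"
    by (intro has_integral_diff has_integral_mult_right niven_has_integral)
  ultimately have "niven_integral 1 - 2 * niven_integral 0 = ?F pi - ?F 0"
    by (rule has_integral_unique[symmetric])
  then show ?thesis
    by (simp add: niven_integral_0 niven_def)
qed

lemma niven_integral_rec:
  "niven_integral (Suc (Suc n)) =
     (4 * real n + 6) * niven_integral (Suc n) - pi\<^sup>2 * niven_integral n"
proof -
  let ?F = "\<lambda>x. (pi - 2 * x) * niven (Suc n) x * sin x - niven (Suc (Suc n)) x * cos x"
  let ?f = "\<lambda>x. niven (Suc (Suc n)) x * sin x
    - ((4 * real n + 6) * (niven (Suc n) x * sin x) - pi\<^sup>2 * (niven n x * sin x))"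
  (* ?F is f' sin - f cos for f = niven (n + 2), so its derivative is (f'' + f) sin. The function
     x (pi - x) has the derivative pi - 2 x, whose square is pi^2 - 4 x (pi - x); this expresses
     f'' through the two preceding functions. *)
  have d: "(?F has_real_derivative ?f x) (at x within {0..pi})" for x
  proof -
    have "(?F has_real_derivative
        (- 2 * niven (Suc n) x + (pi - 2 * x)\<^sup>2 * niven n x + niven (Suc (Suc n)) x) * sin x)
        (at x within {0..pi})"
      by (auto intro!: derivative_eq_intros niven_deriv simp: algebra_simps power2_eq_square)
    also have "(pi - 2 * x)\<^sup>2 * niven n x = pi\<^sup>2 * niven n x - 4 * (x * (pi - x) * niven n x)"
      by (simp add: algebra_simps power2_eq_square)
    finally show ?thesis
      unfolding niven_Suc by (simp add: algebra_simps)
  qed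
  have "(?f has_integral ?F pi - ?F 0) {0..pi}"
    by (rule fundamental_theorem_of_calculus)
       (use d in \<open>auto simp flip: has_real_derivative_iff_has_vector_derivative\<close>)
  moreover have "(?f has_integral niven_integral (Suc (Suc n))
      - ((4 * real n + 6) * niven_integral (Suc n) - pi\<^sup>2 * niven_integral n)) {0..pi}"
    by (intro has_integral_diff has_integral_mult_right niven_has_integral)
  ultimately have "niven_integral (Suc (Suc n))
      - ((4 * real n + 6) * niven_integral (Suc n) - pi\<^sup>2 * niven_integral n) = ?F pi - ?F 0"
    by (rule has_integral_unique[symmetric])
  then show ?thesis
    by (simp add: niven_def)
qed

lemma niven_integral_bound: "\<bar>niven_integral n\<bar> \<le> pi * ((pi\<^sup>2) ^ n / fact n)"
proof -
  have "norm (niven_integral n) \<le> ((pi\<^sup>2) ^ n / fact n) * Henstock_Kurzweil_Integration.content {0..pi}"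
  proof (rule has_integral_bound_real[OF _ finite.emptyI niven_has_integral])
    fix x :: real assume x: "x \<in> {0..pi} - {}"
    have "\<bar>niven n x * sin x\<bar> \<le> \<bar>niven n x\<bar> * 1"
      unfolding abs_mult by (intro mult_left_mono) auto
    also have "\<bar>niven n x\<bar> \<le> (pi\<^sup>2) ^ n / fact n"
    proof -
      have "0 \<le> x * (pi - x)" "x * (pi - x) \<le> pi * pi"
        using x by (auto intro: mult_mono)
      then show ?thesis
        unfolding niven_def power2_eq_square
        by (auto simp: abs_mult power_abs intro!: divide_right_mono power_mono)
    qed
    finally show "norm (niven n x * sin x) \<le> (pi\<^sup>2) ^ n / fact n" by simp
  qed simp
  then show ?thesis by (simp add: mult.commute)
qed

text \<open>If \<open>pi = p / q\<close>, the integers \<open>q ^ n * niven_integral n\<close> vanish from some index on, being less than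
  \<open>1\<close> in absolute value. As \<open>p \<noteq> 0\<close>, the recurrence can be run backwards, so they vanish at all
  indices. But the one at index \<open>0\<close> is \<open>2\<close>.\<close>

theorem pi_irrational: "pi \<notin> \<rat>"
proof
  assume "pi \<in> \<rat>"
  then obtain p q :: int where q: "q > 0" and pq: "pi = of_int p / of_int q"
    by (metis Rats_cases')
  define J where "J n = of_int q ^ n * niven_integral n" for n
  have J_rec: "J (Suc (Suc n)) = of_int ((4 * int n + 6) * q) * J (Suc n) - of_int (p\<^sup>2) * J n" for n
    using q unfolding J_def niven_integral_rec pq
    by (simp add: field_simps power2_eq_square)
  have J_int: "J n \<in> \<int>" for n
  proof (induction n rule: induct_nat_012)
    case (ge2 n)
    then show ?case unfolding J_rec by (intro Ints_diff Ints_mult Ints_of_int)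
  qed (use niven_integral_1 in \<open>auto simp: J_def niven_integral_0\<close>)
  have "(\<lambda>n. pi * (inverse (fact n) * (of_int q * pi\<^sup>2) ^ n)) \<longlonglongrightarrow> pi * 0"
    by (intro tendsto_mult tendsto_const summable_LIMSEQ_zero summable_exp)
  then have "\<forall>\<^sub>F n in sequentially. pi * (inverse (fact n) * (of_int q * pi\<^sup>2) ^ n) < 1"
    by (rule order_tendstoD) simp
  then obtain N where N: "\<And>n. n \<ge> N \<Longrightarrow> pi * (inverse (fact n) * (of_int q * pi\<^sup>2) ^ n) < 1"
    unfolding eventually_sequentially by blast
  have J_0: "J n = 0" if "n \<ge> N" for n
  proof -
    have "\<bar>J n\<bar> \<le> of_int q ^ n * (pi * ((pi\<^sup>2) ^ n / fact n))"
      unfolding J_def abs_mult using q niven_integral_bound[of n]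
      by (intro mult_mono) auto
    also have "\<dots> < 1"
      using N[OF that] by (simp add: field_simps power_mult_distrib)
    finally show ?thesis
      using J_int[of n] Ints_nonzero_abs_less1 by blast
  qed
  have p: "p \<noteq> 0" using pq by auto
  have "J m = 0 \<and> J (Suc m) = 0" if "m \<le> N" for m
    using that
  proof (induction m rule: inc_induct)
    case base
    then show ?case using J_0 by simp
  next
    case (step m)
    then have "of_int (p\<^sup>2) * J m = 0"
      using J_rec[of m] step.IH by simp
    then have "J m = 0" using p by simp
    with step.IH show ?case by simp
  qed
  from this[of 0] show False by (simp add: J_def niven_integral_0)
qed

section \<open>Back-and-forth for coloured dense orders\<close>

lemma finite_sets_separated_by_gap:
  fixes L U :: "real set"
  assumes "finite L" "finite U" "\<And>l u. l \<in> L \<Longrightarrow> u \<in> U \<Longrightarrow> l < u"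
    and "\<And>l. l \<in> L \<Longrightarrow> l < 1" "\<And>u. u \<in> U \<Longrightarrow> -1 < u"
  obtains v w where "-1 \<le> v" "v < w" "w \<le> 1" "\<And>l. l \<in> L \<Longrightarrow> l \<le> v" "\<And>u. u \<in> U \<Longrightarrow> w \<le> u"
proof
  let ?v = "Max (insert (-1) L)" and ?w = "Min (insert 1 U)"
  show "-1 \<le> ?v" "?w \<le> 1" "\<And>l. l \<in> L \<Longrightarrow> l \<le> ?v" "\<And>u. u \<in> U \<Longrightarrow> ?w \<le> u"
    using assms(1,2) by auto
  show "?v < ?w"
    using assms by auto
qed

text \<open>The generic linear order with colours in \<open>C\<close>, for countable \<open>A\<close>. Points are compared through their
  real positions \<open>t\<close>, so that density of a colour can be expressed by the subintervals that it meets.\<close>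

definition dense_colouring ::
    "'a set \<Rightarrow> ('a \<Rightarrow> 'c) \<Rightarrow> ('a \<Rightarrow> real) \<Rightarrow> 'c set \<Rightarrow> bool" where
  "dense_colouring A s t C \<longleftrightarrow>
     s \<in> A \<rightarrow> C \<and> t \<in> A \<rightarrow> {-1<..<1} \<and> inj_on t A \<and>
     (\<forall>c\<in>C. \<forall>u v. -1 \<le> u \<longrightarrow> u < v \<longrightarrow> v \<le> 1 \<longrightarrow> (\<exists>z\<in>A. s z = c \<and> u < t z \<and> t z < v))"

lemma dense_colouringD:
  assumes "dense_colouring A s t C" "c \<in> C" "-1 \<le> u" "u < v" "v \<le> 1"
  shows "\<exists>z\<in>A. s z = c \<and> u < t z \<and> t z < v"
  using assms by (simp add: dense_colouring_def)

lemma dense_colouring_inj: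
  "dense_colouring A s t C \<Longrightarrow> x \<in> A \<Longrightarrow> y \<in> A \<Longrightarrow> t x = t y \<Longrightarrow> x = y"
  by (simp add: dense_colouring_def inj_on_def)

text \<open>Partial isomorphisms are relations rather than functions, so that the back step is the forth step
  for the converse relation. Since positions determine points, the condition on the order forces
  such a relation to be single-valued and injective.\<close>

definition partial_coloured_iso ::
    "'a set \<Rightarrow> ('a \<Rightarrow> 'c) \<Rightarrow> ('a \<Rightarrow> real) \<Rightarrow> 'b set \<Rightarrow> ('b \<Rightarrow> 'c) \<Rightarrow> ('b \<Rightarrow> real) \<Rightarrow>
     ('a \<times> 'b) set \<Rightarrow> bool" where
  "partial_coloured_iso A s t B s' t' P \<longleftrightarrow>
     finite P \<and> P \<subseteq> A \<times> B \<and> (\<forall>(x, y) \<in> P. s x = s' y) \<and>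
     (\<forall>(x, y) \<in> P. \<forall>(x2, y2) \<in> P. t x < t x2 \<longleftrightarrow> t' y < t' y2)"

lemma partial_coloured_iso_converse:
  "partial_coloured_iso A s t B s' t' P \<Longrightarrow> partial_coloured_iso B s' t' A s t (P\<inverse>)"
  unfolding partial_coloured_iso_def by fastforce

text \<open>The finitely many points related so far divide the interval into gaps. The new point \<open>x\<close> lies in one
  of them, and the corresponding gap on the other side contains a point of every colour.\<close>

lemma partial_coloured_iso_forth:
  assumes A: "dense_colouring A s t C" and B: "dense_colouring B s' t' C"
    and P: "partial_coloured_iso A s t B s' t' P" and x: "x \<in> A"
  shows "\<exists>y. partial_coloured_iso A s t B s' t' (insert (x, y) P)"
proof (cases "x \<in> Domain P")
  case True
  then show ?thesis using P by (metis Domain.cases insert_absorb)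
next
  case False
  have fin: "finite P" and sub: "P \<subseteq> A \<times> B" using P by (auto simp: partial_coloured_iso_def)
  have colour: "s a = s' b" if "(a, b) \<in> P" for a b
    using P that by (auto simp: partial_coloured_iso_def)
  have ord: "t a < t c \<longleftrightarrow> t' b < t' d" if "(a, b) \<in> P" "(c, d) \<in> P" for a b c d
    using P that unfolding partial_coloured_iso_def by blast
  have neq: "t a \<noteq> t x" if "(a, b) \<in> P" for a b
  proof
    assume "t a = t x"
    then have "a = x" using dense_colouring_inj[OF A] x sub that by blast
    with that False show False by blast
  qed
  let ?L = "(\<lambda>(a, b). t' b) ` {(a, b) \<in> P. t a < t x}"
  let ?U = "(\<lambda>(a, b). t' b) ` {(a, b) \<in> P. t x < t a}"
  have range: "-1 < t' b \<and> t' b < 1" if "(a, b) \<in> P" for a b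
    using B sub that by (auto simp: dense_colouring_def Pi_iff)
  have "finite ?L" "finite ?U" by (auto intro!: finite_imageI finite_subset[OF _ fin])
  moreover have "l < u" if "l \<in> ?L" "u \<in> ?U" for l u
    using that ord by fastforce
  ultimately obtain v w where vw: "-1 \<le> v" "v < w" "w \<le> 1"
      "\<And>l. l \<in> ?L \<Longrightarrow> l \<le> v" "\<And>u. u \<in> ?U \<Longrightarrow> w \<le> u"
    by (rule finite_sets_separated_by_gap) (use range in auto)
  have "s x \<in> C" using A x by (auto simp: dense_colouring_def)
  then obtain y where y: "y \<in> B" "s' y = s x" "v < t' y" "t' y < w"
    using dense_colouringD[OF B _ vw(1-3)] by blast
  have lo: "t' b < t' y" if "(a, b) \<in> P" "t a < t x" for a b
    using vw(4)[of "t' b"] y that by force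
  have hi: "t' y < t' b" if "(a, b) \<in> P" "t x < t a" for a b
    using vw(5)[of "t' b"] y that by force
  have "(t a < t x \<longleftrightarrow> t' b < t' y) \<and> (t x < t a \<longleftrightarrow> t' y < t' b)" if "(a, b) \<in> P" for a b
    using lo[OF that] hi[OF that] neq[OF that] by linarith
  then have "partial_coloured_iso A s t B s' t' (insert (x, y) P)"
    using x y fin sub colour ord unfolding partial_coloured_iso_def by auto
  then show ?thesis by blast
qed

text \<open>Cantor's argument for coloured orders: two countable dense orders with the same colours are
  isomorphic, by an isomorphism that extends any given finite partial one. A point from an
  enumeration of \<open>A\<close> and one from an enumeration of \<open>B\<close> are added in turn, and the union of the
  resulting chain is the graph of the isomorphism.\<close>

lemma back_and_forth:
  fixes A :: "'a set" and B :: "'b set"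
  assumes A: "dense_colouring A s t C" and B: "dense_colouring B s' t' C"
    and "countable A" "countable B" and P0: "partial_coloured_iso A s t B s' t' P0"
  obtains h where "bij_betw h A B" "\<And>x y. (x, y) \<in> P0 \<Longrightarrow> h x = y"
    "\<And>x. x \<in> A \<Longrightarrow> s' (h x) = s x"
    "\<And>x y. x \<in> A \<Longrightarrow> y \<in> A \<Longrightarrow> t' (h x) < t' (h y) \<longleftrightarrow> t x < t y"
proof -
  let ?iso = "partial_coloured_iso A s t B s' t'"
  have "\<exists>z\<in>A. s z = c" "\<exists>z\<in>B. s' z = c" if "c \<in> C" for c
    using dense_colouringD[OF A that, of "-1" 1] dense_colouringD[OF B that, of "-1" 1] by auto
  then have empty: "A = {} \<longleftrightarrow> B = {}"
    using A B by (fastforce simp: dense_colouring_def)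
  show ?thesis
  proof (cases "A = {}")
    case True
    then have "P0 = {}" using P0 by (auto simp: partial_coloured_iso_def)
    with True empty show ?thesis by (intro that[of undefined]) (auto simp: bij_betw_def)
  next
    case False
    then have ne: "A \<noteq> {}" "B \<noteq> {}" using empty by auto
    have step: "\<exists>Q. ?iso Q \<and> P \<subseteq> Q \<and> from_nat_into A n \<in> Domain Q \<and> from_nat_into B n \<in> Range Q"
      if P: "?iso P" for P n
    proof -
      obtain y where y: "?iso (insert (from_nat_into A n, y) P)"
        using partial_coloured_iso_forth[OF A B P from_nat_into[OF ne(1)]] by blast
      obtain x where "partial_coloured_iso B s' t' A s t
          (insert (from_nat_into B n, x) ((insert (from_nat_into A n, y) P)\<inverse>))"
        using partial_coloured_iso_forth[OF B A partial_coloured_iso_converse[OF y] from_nat_into[OF ne(2)]]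
        by blast
      moreover have "(insert (from_nat_into B n, x) ((insert (from_nat_into A n, y) P)\<inverse>))\<inverse>
          = insert (x, from_nat_into B n) (insert (from_nat_into A n, y) P)"
        by auto
      ultimately have "?iso (insert (x, from_nat_into B n) (insert (from_nat_into A n, y) P))"
        using partial_coloured_iso_converse by metis
      then show ?thesis by (intro exI conjI) auto
    qed
    have "\<exists>P. \<forall>n. (?iso (P n) \<and> P0 \<subseteq> P n) \<and> (P n \<subseteq> P (Suc n) \<and>
        from_nat_into A n \<in> Domain (P (Suc n)) \<and> from_nat_into B n \<in> Range (P (Suc n)))"
    proof (rule dependent_nat_choice)
      fix P :: "('a \<times> 'b) set" and n assume "?iso P \<and> P0 \<subseteq> P"
      then show "\<exists>Q. (?iso Q \<and> P0 \<subseteq> Q) \<and>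
          (P \<subseteq> Q \<and> from_nat_into A n \<in> Domain Q \<and> from_nat_into B n \<in> Range Q)"
        using step[of P n] by (meson order_trans)
    qed (use P0 in blast)
    then obtain P where iso: "\<And>n. ?iso (P n)" and P0_sub: "\<And>n. P0 \<subseteq> P n"
      and mono: "\<And>n. P n \<subseteq> P (Suc n)"
      and dom: "\<And>n. from_nat_into A n \<in> Domain (P (Suc n))"
      and ran: "\<And>n. from_nat_into B n \<in> Range (P (Suc n))"
      by blast
    define R where "R = (\<Union>n. P n)"
    have R_sub: "R \<subseteq> A \<times> B" and R_colour: "\<And>x y. (x, y) \<in> R \<Longrightarrow> s' y = s x"
      using iso by (fastforce simp: R_def partial_coloured_iso_def)+
    have R_ord: "t x < t x2 \<longleftrightarrow> t' y < t' y2" if xy: "(x, y) \<in> R" "(x2, y2) \<in> R" for x y x2 y2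
    proof -
      obtain m n where "(x, y) \<in> P m" "(x2, y2) \<in> P n" using xy by (auto simp: R_def)
      then have "(x, y) \<in> P (max m n)" "(x2, y2) \<in> P (max m n)"
        using lift_Suc_mono_le[of P, OF mono] by (meson max.cobounded1 max.cobounded2 subsetD)+
      then show ?thesis using iso[of "max m n"] unfolding partial_coloured_iso_def by blast
    qed
    have R_fun: "y = y2" if "(x, y) \<in> R" "(x, y2) \<in> R" for x y y2
    proof -
      have "t' y = t' y2" using R_ord[OF that] R_ord[OF that(2,1)] by linarith
      then show ?thesis using dense_colouring_inj[OF B] R_sub that by blast
    qed
    have R_inj: "x = x2" if "(x, y) \<in> R" "(x2, y) \<in> R" for x y x2
    proof -
      have "t x = t x2" using R_ord[OF that] R_ord[OF that(2,1)] by linarith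
      then show ?thesis using dense_colouring_inj[OF A] R_sub that by blast
    qed
    have "\<exists>y. (x, y) \<in> R" if "x \<in> A" for x
      using dom[of "to_nat_on A x"] that \<open>countable A\<close> by (auto simp: R_def)
    then obtain h where h: "\<And>x. x \<in> A \<Longrightarrow> (x, h x) \<in> R" by metis
    have R_onto: "y \<in> Range R" if "y \<in> B" for y
      using ran[of "to_nat_on B y"] that \<open>countable B\<close> by (auto simp: R_def)
    have surj: "y \<in> h ` A" if "y \<in> B" for y
    proof -
      obtain x where x: "(x, y) \<in> R" using R_onto[OF \<open>y \<in> B\<close>] by blast
      then have "x \<in> A" using R_sub by blast
      with x h R_fun show ?thesis by blast
    qed
    show ?thesis
    proof
      show "bij_betw h A B"
        unfolding bij_betw_def
      proof (intro conjI inj_onI)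
        fix x y assume "x \<in> A" "y \<in> A" "h x = h y"
        then show "x = y" using h[of x] h[of y] R_inj by simp
      qed (use surj h R_sub in blast)
      show "h x = y" if "(x, y) \<in> P0" for x y
      proof -
        have "(x, y) \<in> R" using that P0_sub[of 0] by (auto simp: R_def)
        then show ?thesis using R_fun h R_sub by blast
      qed
      show "s' (h x) = s x" if "x \<in> A" for x using h R_colour that by blast
      show "t' (h x) < t' (h y) \<longleftrightarrow> t x < t y" if "x \<in> A" "y \<in> A" for x y
        using h R_ord that by blast
    qed
  qed
qed

section \<open>Charts of a graph\<close>

text \<open>The three sectors of the circle are numbered \<open>-1\<close>, \<open>0\<close> and \<open>1\<close>, in counterclockwise order; they are
  taken cyclically, so that \<open>-1\<close> comes after \<open>1\<close>.\<close>

definition next_sector :: "int \<Rightarrow> int \<Rightarrow> bool" where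
  "next_sector i j \<longleftrightarrow> (j - i) mod 3 = 1"

text \<open>A chart views the graph from the vertex \<open>b\<close>: cut the circle into thirds, beginning at \<open>b\<close>, and
  describe another vertex by the third \<open>sec\<close> that it lies in and by its position \<open>pos\<close> within
  this third, scaled to \<open>{-1<..<1}\<close>. The middle third \<open>0\<close> consists of the neighbours of \<open>b\<close>. Going one
  sector ahead, the angle between two points is more than a third of the circle iff the position
  increases; hence the formula for edges. In this form the graph is nothing but a dense order
  whose points have three colours.\<close>

locale sector_chart =
  fixes V :: "'a set" and E :: "'a \<Rightarrow> 'a \<Rightarrow> bool" and b :: 'a
    and sec :: "'a \<Rightarrow> int" and pos :: "'a \<Rightarrow> real"
  assumes base: "b \<in> V"
    and colouring: "dense_colouring (V - {b}) sec pos {-1, 0, 1}"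
    and base_irrefl: "\<not> E b b"
    and base_edge: "z \<in> V - {b} \<Longrightarrow> E b z \<longleftrightarrow> sec z = 0"
    and base_edge': "z \<in> V - {b} \<Longrightarrow> E z b \<longleftrightarrow> sec z = 0"
    and edge: "y \<in> V - {b} \<Longrightarrow> z \<in> V - {b} \<Longrightarrow> E y z \<longleftrightarrow>
      next_sector (sec y) (sec z) \<and> pos y < pos z \<or> next_sector (sec z) (sec y) \<and> pos z < pos y"
begin

lemma sec_cases:
  assumes "z \<in> V - {b}"
  obtains "sec z = -1" | "sec z = 0" | "sec z = 1"
  using colouring assms by (auto simp: dense_colouring_def Pi_iff)

lemma pos_bounds: "z \<in> V - {b} \<Longrightarrow> -1 < pos z \<and> pos z < 1"
  using colouring by (auto simp: dense_colouring_def Pi_iff)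

lemma pos_inj: "y \<in> V - {b} \<Longrightarrow> z \<in> V - {b} \<Longrightarrow> pos y = pos z \<Longrightarrow> y = z"
  by (rule dense_colouring_inj[OF colouring])

lemma dense:
  assumes "i \<in> {-1, 0, 1}" "-1 \<le> u" "u < v" "v \<le> 1"
  obtains z where "z \<in> V - {b}" "sec z = i" "u < pos z" "pos z < v"
  using colouring assms unfolding dense_colouring_def by meson

lemma base_sym: "z \<in> V \<Longrightarrow> E b z \<longleftrightarrow> E z b"
  using base_edge base_edge' by (cases "z = b") auto

text \<open>The neighbours of \<open>b\<close> that are adjacent to \<open>w\<close> form a final segment if \<open>w\<close> lies in the sector
  before them and an initial segment if it lies in the sector after them. So adjacency reveals how
  \<open>w\<close> compares to them, once its sector is known.\<close>

lemma pos_less_iff: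
  assumes "w \<in> V - {b}" "sec w \<noteq> 0" "p \<in> V - {b}" "sec p = 0"
  shows "pos w < pos p \<longleftrightarrow> (E w p \<longleftrightarrow> sec w = -1)"
  using assms(1)
proof (cases rule: sec_cases)
  case 3
  then have "pos w \<noteq> pos p" using pos_inj[OF assms(1,3)] assms(4) by auto
  with 3 assms(4) edge[OF assms(1,3)] show ?thesis by (auto simp: next_sector_def)
qed (use assms edge[OF assms(1,3)] in \<open>simp_all add: next_sector_def\<close>)

text \<open>Reflecting the circle at the diameter through \<open>b\<close> reverses the cyclic order of the sectors and the
  order of the positions, and both changes cancel in the formula for edges.\<close>

lemma mirror: "sector_chart V E b (\<lambda>z. - sec z) (\<lambda>z. - pos z)"
proof
  show "dense_colouring (V - {b}) (\<lambda>z. - sec z) (\<lambda>z. - pos z) {-1, 0, 1}"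
    unfolding dense_colouring_def
  proof (intro conjI ballI allI impI)
    fix c :: int and u v :: real assume "c \<in> {-1, 0, 1}" "-1 \<le> u" "u < v" "v \<le> 1"
    then obtain z where "z \<in> V - {b}" "sec z = - c" "- v < pos z" "pos z < - u"
      using dense[of "- c" "- v" "- u"] by force
    then show "\<exists>z\<in>V - {b}. - sec z = c \<and> u < - pos z \<and> - pos z < v" by force
  qed (use colouring in \<open>auto simp: dense_colouring_def inj_on_def Pi_iff\<close>)
  show "E y z \<longleftrightarrow> next_sector (- sec y) (- sec z) \<and> - pos y < - pos z \<or>
      next_sector (- sec z) (- sec y) \<and> - pos z < - pos y" if "y \<in> V - {b}" "z \<in> V - {b}" for y z
    using edge[OF that] by (auto simp: next_sector_def algebra_simps)
qed (use base base_irrefl base_edge base_edge' in simp_all)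

text \<open>Two vertices that are less than a third of the circle apart have a common neighbour on the opposite
  side, while adjacent ones have none, because the graph has no triangles. This makes non-adjacency
  a positive existential property, which endomorphisms therefore preserve.\<close>

lemma nonadjacent_iff_common_neighbour:
  assumes y: "y \<in> V"
  shows "\<not> E b y \<longleftrightarrow> (\<exists>z\<in>V. E b z \<and> E y z)"
proof (cases "y = b")
  case True
  obtain z where "z \<in> V - {b}" "sec z = 0" by (rule dense[of 0 "-1" 1]) auto
  with True base_irrefl base_edge show ?thesis by blast
next
  case False
  with y have y': "y \<in> V - {b}" by simp
  then show ?thesis
  proof (cases rule: sec_cases)
    case 1
    obtain z where z: "z \<in> V - {b}" "sec z = 0" "pos y < pos z"
      by (rule dense[of 0 "pos y" 1]) (use pos_bounds[OF y'] in auto)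
    with 1 y' have "E y z" by (simp add: edge next_sector_def)
    with z 1 y' base_edge show ?thesis by auto
  next
    case 3
    obtain z where z: "z \<in> V - {b}" "sec z = 0" "pos z < pos y"
      by (rule dense[of 0 "-1" "pos y"]) (use pos_bounds[OF y'] in auto)
    with 3 y' have "E y z" by (simp add: edge next_sector_def)
    with z 3 y' base_edge show ?thesis by auto
  next
    case 2
    have "\<not> (E b z \<and> E y z)" if "z \<in> V" for z
    proof (cases "z = b")
      case False
      with that base_edge edge[OF y', of z] 2 show ?thesis by (auto simp: next_sector_def)
    qed (use base_irrefl in simp)
    with 2 y' base_edge show ?thesis by blast
  qed
qed

lemma separating_neighbour:
  assumes y: "y \<in> V - {b}"
  obtains z where "z \<in> V" "E b z" "\<not> E z y"
  using y
proof (cases rule: sec_cases)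
  case 1
  obtain z where z: "z \<in> V - {b}" "sec z = 0" "pos z < pos y"
    by (rule dense[of 0 "-1" "pos y"]) (use pos_bounds[OF y] in auto)
  with 1 y show ?thesis by (intro that[of z]) (auto simp: edge base_edge next_sector_def)
next
  case 2
  with y show ?thesis by (intro that[of y]) (auto simp: edge base_edge next_sector_def)
next
  case 3
  obtain z where z: "z \<in> V - {b}" "sec z = 0" "pos y < pos z"
    by (rule dense[of 0 "pos y" 1]) (use pos_bounds[OF y] in auto)
  with 3 y show ?thesis by (intro that[of z]) (auto simp: edge base_edge next_sector_def)
qed

end

text \<open>Edges are preserved by definition and non-edges because a common neighbour is mapped to a common
  neighbour. Distinct vertices cannot be identified, since some vertex is adjacent to only one of
  them.\<close>

lemma endomorphism_embedding:
  assumes charts: "\<And>b. b \<in> V \<Longrightarrow> \<exists>sec pos. sector_chart V E b sec pos"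
    and e: "graph_endomorphism V E e"
  shows "inj_on e V" "\<And>x y. x \<in> V \<Longrightarrow> y \<in> V \<Longrightarrow> E (e x) (e y) \<longleftrightarrow> E x y"
proof -
  have eV: "e x \<in> V" if "x \<in> V" for x using e that by (auto simp: graph_endomorphism_def)
  have pres: "E (e x) (e y)" if "x \<in> V" "y \<in> V" "E x y" for x y
    using e that by (auto simp: graph_endomorphism_def)
  have cn: "\<not> E x y \<longleftrightarrow> (\<exists>z\<in>V. E x z \<and> E y z)" if "x \<in> V" "y \<in> V" for x y
  proof -
    obtain sec pos where "sector_chart V E x sec pos" using charts[OF \<open>x \<in> V\<close>] by blast
    then show ?thesis using \<open>y \<in> V\<close> by (rule sector_chart.nonadjacent_iff_common_neighbour)
  qed
  show iff: "E (e x) (e y) \<longleftrightarrow> E x y" if xy: "x \<in> V" "y \<in> V" for x y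
    using cn[OF xy] cn[of "e x" "e y"] pres xy eV by blast
  show "inj_on e V"
  proof (rule inj_onI, rule ccontr)
    fix x y assume xy: "x \<in> V" "y \<in> V" "e x = e y" "x \<noteq> y"
    obtain sec pos where "sector_chart V E x sec pos" using charts[OF xy(1)] by blast
    then obtain z where z: "z \<in> V" "E x z" "\<not> E z y"
      using xy(2,4) by (auto elim: sector_chart.separating_neighbour)
    obtain sec' pos' where "sector_chart V E (e x) sec' pos'" using charts[OF eV[OF xy(1)]] by blast
    from sector_chart.base_sym[OF this eV[OF z(1)]] have "E (e z) (e x)"
      using pres[OF xy(1) z(1,2)] by simp
    with z xy iff show False by metis
  qed
qed

section \<open>Embeddings between charts\<close>

locale chart_embedding =
  S: sector_chart V E b s t + T: sector_chart W E' b' s' t'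
  for V :: "'a set" and E b s t and W :: "'b set" and E' b' s' t' +
  fixes e :: "'a \<Rightarrow> 'b"
  assumes e_range: "e \<in> V \<rightarrow> W" and e_base: "e b = b'" and e_inj: "inj_on e V"
    and e_edge: "x \<in> V \<Longrightarrow> y \<in> V \<Longrightarrow> E' (e x) (e y) \<longleftrightarrow> E x y"
begin

lemma e_mem: "z \<in> V - {b} \<Longrightarrow> e z \<in> W - {b'}"
  using e_range e_base inj_onD[OF e_inj, of z b] S.base by (auto simp: Pi_iff)

lemma sec_0_iff: "z \<in> V - {b} \<Longrightarrow> s' (e z) = 0 \<longleftrightarrow> s z = 0"
  using e_edge[OF S.base, of z] S.base_edge[of z] T.base_edge[OF e_mem, of z] e_base by simp

lemma kept_less_iff:
  assumes "w \<in> V - {b}" "s w \<noteq> 0" "s' (e w) = s w" "p \<in> V - {b}" "s p = 0"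
  shows "t' (e w) < t' (e p) \<longleftrightarrow> t w < t p"
proof -
  have "E' (e w) (e p) \<longleftrightarrow> E w p" using e_edge assms(1,4) by blast
  then show ?thesis
    using S.pos_less_iff[of w p] T.pos_less_iff[of "e w" "e p"] e_mem sec_0_iff assms by metis
qed

text \<open>If the embedding exchanges the two outer sectors at \<open>w\<close>, an initial segment of the neighbours of
  \<open>b\<close> is mapped into a final one or conversely, so comparisons with \<open>w\<close> are reversed.\<close>

lemma flipped_less_iff:
  assumes w: "w \<in> V - {b}" "s w \<noteq> 0" "s' (e w) \<noteq> s w" and p: "p \<in> V - {b}" "s p = 0"
  shows "t' (e p) < t' (e w) \<longleftrightarrow> t w < t p"
proof -
  have "s' (e w) = -1 \<longleftrightarrow> s w \<noteq> -1"
    using S.sec_cases[OF w(1)] T.sec_cases[OF e_mem[OF w(1)]] sec_0_iff[OF w(1)] w by metis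
  then have "t' (e w) < t' (e p) \<longleftrightarrow> \<not> t w < t p"
    using S.pos_less_iff[of w p] T.pos_less_iff[of "e w" "e p"] w p e_mem sec_0_iff e_edge
    by (metis Diff_iff)
  moreover have "t' (e w) \<noteq> t' (e p)"
    using T.pos_inj[OF e_mem e_mem, of w p] w p sec_0_iff by metis
  ultimately show ?thesis by linarith
qed

text \<open>An embedding either keeps the sectors of all vertices or exchanges the outer sectors for all of
  them. For if \<open>w0\<close> is kept and \<open>z\<close> is exchanged, choose neighbours \<open>q\<close> and \<open>p\<close> of \<open>b\<close> whose positions
  lie below and above those of both. Then \<open>w0\<close> shows that the images of \<open>q\<close> and \<open>p\<close> are in the same
  order as \<open>q\<close> and \<open>p\<close>, and \<open>z\<close> shows that they are in the opposite order.\<close>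

lemma sec_kept:
  assumes w0: "w0 \<in> V - {b}" "s w0 \<noteq> 0" "s' (e w0) = s w0" and z: "z \<in> V - {b}"
  shows "s' (e z) = s z"
proof (cases "s z = 0")
  case True
  then show ?thesis using sec_0_iff[OF z] by simp
next
  case False
  show ?thesis
  proof (rule ccontr)
    assume flipped: "s' (e z) \<noteq> s z"
    obtain p where p: "p \<in> V - {b}" "s p = 0" "max (t w0) (t z) < t p"
      by (rule S.dense[of 0 "max (t w0) (t z)" 1]) (use S.pos_bounds[OF w0(1)] S.pos_bounds[OF z] in auto)
    obtain q where q: "q \<in> V - {b}" "s q = 0" "t q < min (t w0) (t z)"
      by (rule S.dense[of 0 "-1" "min (t w0) (t z)"]) (use S.pos_bounds[OF w0(1)] S.pos_bounds[OF z] in auto)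
    have "t' (e w0) < t' (e p)" "\<not> t' (e w0) < t' (e q)"
      using kept_less_iff[OF w0] p q by auto
    moreover have "t' (e p) < t' (e z)" "\<not> t' (e q) < t' (e z)"
      using flipped_less_iff[OF z False flipped] p q by auto
    ultimately show False by linarith
  qed
qed

text \<open>Adjacency decides the comparisons between a middle and an outer vertex. All others reduce to
  these, through a vertex that lies between the two and is of the other kind.\<close>

lemma pos_mono_if_sec_kept:
  assumes kept: "\<And>z. z \<in> V - {b} \<Longrightarrow> s' (e z) = s z"
    and y: "y \<in> V - {b}" and z: "z \<in> V - {b}" and less: "t y < t z"
  shows "t' (e y) < t' (e z)"
proof -
  have up: "t' (e w) < t' (e p)"
    if "w \<in> V - {b}" "s w \<noteq> 0" "p \<in> V - {b}" "s p = 0" "t w < t p" for w p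
    using kept_less_iff[of w p] kept that by blast
  have down: "t' (e p) < t' (e w)"
    if "w \<in> V - {b}" "s w \<noteq> 0" "p \<in> V - {b}" "s p = 0" "t p < t w" for w p
  proof -
    have "t' (e w) \<noteq> t' (e p)" using T.pos_inj[OF e_mem e_mem, of w p] kept that by metis
    moreover have "\<not> t' (e w) < t' (e p)" using kept_less_iff[of w p] kept that by auto
    ultimately show ?thesis by linarith
  qed
  have between: "\<exists>w\<in>V - {b}. s w = i \<and> t y < t w \<and> t w < t z" if "i \<in> {-1, 0, 1}" for i
    using S.dense[of i "t y" "t z"] that less S.pos_bounds[OF y] S.pos_bounds[OF z]
    by (metis less_imp_le)
  consider "s y = 0" "s z = 0" | "s y \<noteq> 0" "s z = 0" | "s y = 0" "s z \<noteq> 0" | "s y \<noteq> 0" "s z \<noteq> 0"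
    by blast
  then show ?thesis
  proof cases
    case 1
    obtain w where "w \<in> V - {b}" "s w = 1" "t y < t w" "t w < t z" using between[of 1] by auto
    then show ?thesis using down[of w y] up[of w z] 1 y z by auto
  next
    case 4
    obtain w where "w \<in> V - {b}" "s w = 0" "t y < t w" "t w < t z" using between[of 0] by auto
    then show ?thesis using up[of y w] down[of z w] 4 y z by auto
  qed (use up down y z less in auto)
qed

end

section \<open>Graphs with sector charts are model-complete cores\<close>

text \<open>In the charts at \<open>b\<close> and at its image, an embedding that keeps sectors is an embedding of coloured
  orders, so its restriction to a finite set extends to an isomorphism of these orders. As sectors
  and positions determine the edges, this is a graph isomorphism.\<close>

lemma embedding_extends_to_isomorphism:
  assumes "chart_embedding V E b s t W E' b' s' t' e"
    and kept: "\<And>z. z \<in> V - {b} \<Longrightarrow> s' (e z) = s z"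
    and "countable V" "countable W" and F: "finite F" "F \<subseteq> V"
  obtains a where "bij_betw a V W" "\<And>x y. x \<in> V \<Longrightarrow> y \<in> V \<Longrightarrow> E x y \<longleftrightarrow> E' (a x) (a y)"
    "\<And>x. x \<in> F \<Longrightarrow> a x = e x"
proof -
  interpret chart_embedding V E b s t W E' b' s' t' e by fact
  define P where "P = (\<lambda>x. (x, e x)) ` (F - {b})"
  have lt: "t' (e x) < t' (e y) \<longleftrightarrow> t x < t y" if "x \<in> V - {b}" "y \<in> V - {b}" for x y
    using pos_mono_if_sec_kept[OF kept that] pos_mono_if_sec_kept[OF kept that(2,1)]
      S.pos_inj[OF that] by force
  have iso: "partial_coloured_iso (V - {b}) s t (W - {b'}) s' t' P"
    unfolding partial_coloured_iso_def
  proof (intro conjI)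
    show "P \<subseteq> (V - {b}) \<times> (W - {b'})" using F(2) e_mem unfolding P_def by blast
    show "\<forall>(x, y)\<in>P. s x = s' y" using F(2) kept by (auto simp: P_def subset_iff)
    show "\<forall>(x, y)\<in>P. \<forall>(x2, y2)\<in>P. t x < t x2 \<longleftrightarrow> t' y < t' y2"
      using F(2) lt by (auto simp: P_def subset_iff)
  qed (use F(1) in \<open>simp add: P_def\<close>)
  obtain h where h: "bij_betw h (V - {b}) (W - {b'})"
    and hP: "\<And>x y. (x, y) \<in> P \<Longrightarrow> h x = y"
    and h_sec: "\<And>x. x \<in> V - {b} \<Longrightarrow> s' (h x) = s x"
    and h_pos: "\<And>x y. x \<in> V - {b} \<Longrightarrow> y \<in> V - {b} \<Longrightarrow> t' (h x) < t' (h y) \<longleftrightarrow> t x < t y"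
    by (rule back_and_forth[OF S.colouring T.colouring _ _ iso])
       (use \<open>countable V\<close> \<open>countable W\<close> in \<open>auto intro: countable_Diff\<close>)
  have h_mem: "h x \<in> W - {b'}" if "x \<in> V - {b}" for x
    using h that by (rule bij_betwE[THEN bspec])
  define a where "a = h(b := b')"
  have a: "a b = b'" "\<And>x. x \<in> V - {b} \<Longrightarrow> a x = h x" by (auto simp: a_def)
  show thesis
  proof
    have "bij_betw a (V - {b}) (W - {b'})"
      using h a(2) by (subst bij_betw_cong[of _ _ h]) auto
    moreover have "bij_betw a {b} {b'}" using a by (auto simp: bij_betw_def)
    ultimately have "bij_betw a ((V - {b}) \<union> {b}) ((W - {b'}) \<union> {b'})"
      by (rule bij_betw_combine) auto
    then show "bij_betw a V W"
      using S.base T.base by (simp add: insert_absorb)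
    show "a x = e x" if "x \<in> F" for x
      using that hP[of x "e x"] e_base F by (auto simp: a_def P_def)
    show "E x y \<longleftrightarrow> E' (a x) (a y)" if "x \<in> V" "y \<in> V" for x y
    proof -
      consider "x = b" "y = b" | "x = b" "y \<in> V - {b}" | "x \<in> V - {b}" "y = b"
        | "x \<in> V - {b}" "y \<in> V - {b}"
        using \<open>x \<in> V\<close> \<open>y \<in> V\<close> by blast
      then show ?thesis
      proof cases
        case 1
        then show ?thesis using a S.base_irrefl T.base_irrefl by simp
      next
        case 2
        then show ?thesis using a S.base_edge T.base_edge h_mem h_sec by simp
      next
        case 3
        then show ?thesis using a S.base_edge' T.base_edge' h_mem h_sec by simp
      next
        case 4
        then show ?thesis
          using a S.edge[of x y] T.edge[of "h x" "h y"] h_mem h_sec h_pos by simp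
      qed
    qed
  qed
qed

text \<open>If the embedding exchanges the outer sectors at one vertex \<open>w\<close>, the chart at the image of \<open>b\<close> is
  replaced by its mirror image. Then \<open>w\<close> keeps its sector, and with it all other vertices do.\<close>

theorem model_complete_core_if_sector_charts:
  assumes "countable V" and charts: "\<And>b. b \<in> V \<Longrightarrow> \<exists>sec pos. sector_chart V E b sec pos"
  shows "model_complete_core V E"
  unfolding model_complete_core_def
proof (intro allI impI, elim conjE)
  fix F e assume F: "finite F" "F \<subseteq> V" and e: "graph_endomorphism V E e"
  show "\<exists>a. graph_automorphism V E a \<and> (\<forall>x\<in>F. e x = a x)"
  proof (cases "V = {}")
    case True
    then show ?thesis using F by (auto simp: graph_automorphism_def bij_betw_def)
  next
    case False
    then obtain b where b: "b \<in> V" by blast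
    have eV: "e \<in> V \<rightarrow> V" using e by (simp add: graph_endomorphism_def)
    then have "e b \<in> V" using b by blast
    with b charts obtain s t s' t' where s: "sector_chart V E b s t" and s': "sector_chart V E (e b) s' t'"
      by meson
    have emb: "chart_embedding V E b s t V E (e b) s1 t1 e"
      if "sector_chart V E (e b) s1 t1" for s1 t1
      using s that eV endomorphism_embedding[OF charts e]
      by (simp add: chart_embedding_def chart_embedding_axioms_def)
    interpret S: sector_chart V E b s t by fact
    obtain w where w: "w \<in> V - {b}" "s w = 1" by (rule S.dense[of 1 "-1" 1]) auto
    have "\<exists>s1 t1. sector_chart V E (e b) s1 t1 \<and> s1 (e w) = s w"
    proof (cases "s' (e w) = s w")
      case False
      interpret M: chart_embedding V E b s t V E "e b" s' t' e by (rule emb[OF s'])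
      have "s' (e w) = - 1"
        using M.T.sec_cases[OF M.e_mem[OF w(1)]] M.sec_0_iff[OF w(1)] False w(2) by fastforce
      then show ?thesis using M.T.mirror w(2)
        by (intro exI[of _ "\<lambda>z. - s' z"] exI[of _ "\<lambda>z. - t' z"]) simp
    qed (use s' in blast)
    then obtain s1 t1 where s1: "sector_chart V E (e b) s1 t1" and kept: "s1 (e w) = s w" by blast
    have "s1 (e z) = s z" if "z \<in> V - {b}" for z
      using chart_embedding.sec_kept[OF emb[OF s1] w(1) _ kept that] w(2) by simp
    then obtain a where "bij_betw a V V" "\<And>x y. x \<in> V \<Longrightarrow> y \<in> V \<Longrightarrow> E x y \<longleftrightarrow> E (a x) (a y)"
      "\<And>x. x \<in> F \<Longrightarrow> a x = e x"
      by (rule embedding_extends_to_isomorphism[OF emb[OF s1] _ assms(1,1) F]) blast+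
    then show ?thesis unfolding graph_automorphism_def by metis
  qed
qed

section \<open>Charts of $\mathbb{C}_3$\<close>

lemma cis_Arg2pi: "norm z = 1 \<Longrightarrow> cis (Arg2pi z) = z"
  using complex_norm_eq_1_exp[of z] by (simp add: cis_conv_exp)

lemma Arg2pi_cis: "0 \<le> t \<Longrightarrow> t < 2 * pi \<Longrightarrow> Arg2pi (cis t) = t"
  by (rule Arg2pi_unique[of 1]) (auto simp: cis_conv_exp)

text \<open>An angle that is rational both in radians and as a part of a full turn is a multiple of a full turn,
  by the irrationality of \<open>pi\<close>. So no two vertices are exactly one or two thirds of the circle apart.\<close>

lemma rational_angle_commensurable_with_pi:
  assumes "rational_angle x y" "norm x = 1" "y = cis d * x" "d = q * pi" "q \<in> \<rat>"
  shows "y = x"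
proof -
  obtain r where r: "r \<in> \<rat>" "y = cis r * x"
    using assms(1) by (auto simp: rational_angle_def)
  with assms(2,3) have "cis r = cis d" by auto
  then have "cis (r - d) = 1" by (simp add: cis_divide[symmetric])
  then have "cos (r - d) = 1" by (metis cis.sel(1) one_complex.sel(1))
  then obtain n :: int where "r - d = of_int n * 2 * pi"
    by (auto simp: cos_one_2pi_int)
  then have eq: "r = (q + 2 * of_int n) * pi" using assms(4) by (simp add: algebra_simps)
  have "q + 2 * of_int n = 0"
  proof (rule ccontr)
    assume "q + 2 * of_int n \<noteq> 0"
    then have "pi = r / (q + 2 * of_int n)" using eq by simp
    moreover have "r / (q + 2 * of_int n) \<in> \<rat>" using r(1) assms(5) by simp
    ultimately show False using pi_irrational by simp
  qed
  with eq r show ?thesis by simp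
qed

definition C3_sec :: "complex \<Rightarrow> complex \<Rightarrow> int" where
  "C3_sec b z = (if arc_length b z < 2 * pi / 3 then -1 else if arc_length b z < 4 * pi / 3 then 0 else 1)"

text \<open>The sector \<open>i\<close> has its midpoint at the angle \<open>pi + i * (2 * pi / 3)\<close> from \<open>b\<close> and extends by \<open>pi / 3\<close>
  to either side.\<close>

definition C3_pos :: "complex \<Rightarrow> complex \<Rightarrow> real" where
  "C3_pos b z = (arc_length b z - pi - of_int (C3_sec b z) * (2 * pi / 3)) / (pi / 3)"

lemma arc_length_bounds: "0 \<le> arc_length b z" "arc_length b z < 2 * pi"
  using Arg2pi[of "z / b"] by (auto simp: arc_length_def)

lemma cis_arc_length: "norm b = 1 \<Longrightarrow> norm z = 1 \<Longrightarrow> z = cis (arc_length b z) * b"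
  using cis_Arg2pi[of "z / b"] by (auto simp: arc_length_def norm_divide)

lemma arc_length_via_base:
  assumes "norm b = 1" "norm y = 1" "norm z = 1"
  shows "arc_length y z = (if arc_length b y \<le> arc_length b z then arc_length b z - arc_length b y
    else arc_length b z - arc_length b y + 2 * pi)"
proof -
  let ?y = "arc_length b y" and ?z = "arc_length b z"
  have "z / y = cis ?z / cis ?y"
    using cis_arc_length[OF assms(1,2)] cis_arc_length[OF assms(1,3)] assms(1)
    by (metis mult_divide_mult_cancel_right norm_zero zero_neq_one)
  then have zy: "z / y = cis (?z - ?y)" by (simp add: cis_divide)
  then have zy': "z / y = cis (?z - ?y + 2 * pi)" by (simp add: cis_mult[symmetric])
  show ?thesis
  proof (cases "?y \<le> ?z")
    case True
    then show ?thesis unfolding arc_length_def[of y z] zy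
      using arc_length_bounds[of b y] arc_length_bounds[of b z] by (simp add: Arg2pi_cis)
  next
    case False
    then show ?thesis unfolding arc_length_def[of y z] zy'
      using arc_length_bounds[of b y] arc_length_bounds[of b z] by (simp add: Arg2pi_cis)
  qed
qed

lemma C3_edge_via_base:
  assumes "norm b = 1" "norm y = 1" "norm z = 1"
  shows "C3_edge y z \<longleftrightarrow> 2 * pi / 3 < \<bar>arc_length b z - arc_length b y\<bar> \<and>
    \<bar>arc_length b z - arc_length b y\<bar> < 4 * pi / 3"
  unfolding C3_edge_def arc_length_via_base[OF assms(1,2,3)] arc_length_via_base[OF assms(1,3,2)]
  using pi_gt_zero by (auto simp: abs_if)

text \<open>The angle from \<open>b\<close> is continuous at every point of the circle but \<open>b\<close> itself, so the vertices near
  the point in the middle of the arc have angles in the given range.\<close>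

lemma dense_angles:
  assumes "norm b = 1" "sphere 0 1 \<subseteq> closure V" "0 \<le> u" "u < v" "v \<le> 2 * pi"
  shows "\<exists>z\<in>V. u < arc_length b z \<and> arc_length b z < v"
proof -
  define m where "m = (u + v) / 2"
  have m: "u < m" "m < v" using assms by (auto simp: m_def)
  define c where "c = cis m * b"
  have b0: "b \<noteq> 0" using assms(1) by auto
  have cm: "arc_length b c = m"
    using m assms(3-5) b0 by (simp add: arc_length_def c_def Arg2pi_cis)
  have "c / b \<notin> \<real>\<^sub>\<ge>\<^sub>0"
  proof
    assume "c / b \<in> \<real>\<^sub>\<ge>\<^sub>0"
    then have "Arg2pi (c / b) = 0" by (auto simp: Arg2pi_eq_0 nonneg_Reals_def)
    with cm m assms(3) show False by (simp add: arc_length_def)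
  qed
  then have "isCont Arg2pi (c / b)" by (rule continuous_at_Arg2pi)
  then have "isCont (\<lambda>z. Arg2pi (z / b)) c"
    by (rule isCont_o2[rotated]) (use b0 in \<open>auto intro!: continuous_intros\<close>)
  then have "isCont (arc_length b) c" by (simp add: arc_length_def[abs_def])
  then have "(arc_length b \<longlongrightarrow> m) (at c)" by (simp add: isCont_def cm)
  then have "\<forall>\<^sub>F z in at c. arc_length b z \<in> {u<..<v}"
    by (rule topological_tendstoD) (use m in auto)
  then obtain d where d: "d > 0" "\<And>z. z \<noteq> c \<Longrightarrow> dist z c < d \<Longrightarrow> arc_length b z \<in> {u<..<v}"
    unfolding eventually_at by auto
  have "c \<in> closure V" using assms(1,2) by (auto simp: c_def norm_mult)
  then obtain z where "z \<in> V" "dist z c < d" using d(1) closure_approachable by blast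
  then show ?thesis using d(2)[of z] cm m by (cases "z = c") auto
qed

text \<open>Inside a sector, the position is an affine function of the angle. Two vertices with the same position
  differ by a multiple of a third of the circle, so positions determine vertices; likewise no vertex
  lies on the border of two sectors.\<close>

lemma C3_sector_chart:
  assumes V: "C3_vertex_set V" and b: "b \<in> V"
  shows "sector_chart V C3_edge b (C3_sec b) (C3_pos b)"
proof -
  have sphere: "V \<subseteq> sphere 0 1" and closure: "sphere 0 1 \<subseteq> closure V"
    and rat: "\<And>x y. x \<in> V \<Longrightarrow> y \<in> V \<Longrightarrow> x \<noteq> y \<Longrightarrow> rational_angle x y"
    using V by (auto simp: C3_vertex_set_def)
  have norm: "norm z = 1" if "z \<in> V" for z using sphere that by auto
  let ?a = "arc_length b"
  have commens: "x = y" if "x \<in> V" "y \<in> V" "?a y - ?a x = q * pi" "q \<in> \<rat>" for x y q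
  proof (rule ccontr)
    assume "x \<noteq> y"
    have "cis (?a y - ?a x) * x = cis (?a y) * b"
      using cis_arc_length[OF norm[OF b] norm[OF that(1)]]
      by (metis cis_mult diff_add_cancel mult.assoc)
    also have "\<dots> = y" using cis_arc_length[OF norm[OF b] norm[OF that(2)]] by simp
    finally have "y = x"
      using rational_angle_commensurable_with_pi rat[OF that(1,2) \<open>x \<noteq> y\<close>] norm[OF that(1)] that(3,4)
      by metis
    with \<open>x \<noteq> y\<close> show False by simp
  qed
  have ab: "?a b = 0" using norm[OF b] Arg2pi_cis[of 0] by (auto simp: arc_length_def)
  have a0: "?a z \<noteq> 0" and a1: "?a z \<noteq> 2 * pi / 3" and a2: "?a z \<noteq> 4 * pi / 3"
    if "z \<in> V - {b}" for z
    using commens[OF b, of z 0] commens[OF b, of z "2 / 3"] commens[OF b, of z "4 / 3"] that ab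
    by auto
  have cases: "C3_sec b z = -1 \<and> 0 < ?a z \<and> ?a z < 2 * pi / 3 \<or>
      C3_sec b z = 0 \<and> 2 * pi / 3 < ?a z \<and> ?a z < 4 * pi / 3 \<or>
      C3_sec b z = 1 \<and> 4 * pi / 3 < ?a z \<and> ?a z < 2 * pi" if "z \<in> V - {b}" for z
    using a0[OF that] a1[OF that] a2[OF that] arc_length_bounds[of b z] by (auto simp: C3_sec_def)
  have a_eq: "?a z = pi + of_int (C3_sec b z) * (2 * pi / 3) + C3_pos b z * (pi / 3)" for z
    by (simp add: C3_pos_def field_simps)
  have pos_less: "C3_pos b y < C3_pos b z \<longleftrightarrow>
      ?a y - of_int (C3_sec b y) * (2 * pi / 3) < ?a z - of_int (C3_sec b z) * (2 * pi / 3)" for y z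
    by (simp add: a_eq[of y] a_eq[of z])
  show ?thesis
  proof
    show "b \<in> V" by fact
    show "\<not> C3_edge b b" using pi_gt_zero by (simp add: C3_edge_via_base[of b b b] norm[OF b])
    show "C3_edge b z \<longleftrightarrow> C3_sec b z = 0" "C3_edge z b \<longleftrightarrow> C3_sec b z = 0"
      if "z \<in> V - {b}" for z
      using cases[OF that] that pi_gt_zero by (auto simp: C3_edge_via_base[of b] norm b ab)
    show "C3_edge y z \<longleftrightarrow> next_sector (C3_sec b y) (C3_sec b z) \<and> C3_pos b y < C3_pos b z \<or>
        next_sector (C3_sec b z) (C3_sec b y) \<and> C3_pos b z < C3_pos b y"
      if yz: "y \<in> V - {b}" "z \<in> V - {b}" for y z
    proof -
      have "C3_edge y z \<longleftrightarrow> 2 * pi / 3 < \<bar>?a z - ?a y\<bar> \<and> \<bar>?a z - ?a y\<bar> < 4 * pi / 3"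
        using yz norm b by (simp add: C3_edge_via_base[of b])
      then show ?thesis
        using cases[OF yz(1)] cases[OF yz(2)] pi_gt_zero unfolding pos_less
        by (elim disjE conjE) (simp_all add: next_sector_def abs_if, argo+)
    qed
    show "dense_colouring (V - {b}) (C3_sec b) (C3_pos b) {-1, 0, 1}"
      unfolding dense_colouring_def
    proof (intro conjI ballI allI impI)
      show "C3_sec b \<in> V - {b} \<rightarrow> {-1, 0, 1}" using cases by auto
      show "C3_pos b \<in> V - {b} \<rightarrow> {-1<..<1}"
      proof
        fix z assume "z \<in> V - {b}"
        from cases[OF this] show "C3_pos b z \<in> {-1<..<1}"
          by (auto simp: C3_pos_def field_simps)
      qed
      show "inj_on (C3_pos b) (V - {b})"
      proof (rule inj_onI)
        fix y z assume yz: "y \<in> V - {b}" "z \<in> V - {b}" "C3_pos b y = C3_pos b z"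
        then have "?a z - ?a y = ((of_int (C3_sec b z) - of_int (C3_sec b y)) * (2 / 3)) * pi"
          by (simp add: a_eq algebra_simps)
        then show "y = z" by (rule commens[rotated 2]) (use yz in auto)
      qed
    next
      fix c :: int and u v :: real
      assume c: "c \<in> {-1, 0, 1}" and uv: "-1 \<le> u" "u < v" "v \<le> 1"
      (* the angle from b of the point at position x in the sector c *)
      let ?f = "\<lambda>x. pi + of_int c * (2 * pi / 3) + x * (pi / 3)"
      have f: "x \<le> y \<longleftrightarrow> ?f x \<le> ?f y" "x < y \<longleftrightarrow> ?f x < ?f y" for x y by auto
      have "0 \<le> ?f (-1)" "?f 1 \<le> 2 * pi" using c by auto
      then have "0 \<le> ?f u" "?f u < ?f v" "?f v \<le> 2 * pi" using uv f by (meson order_trans)+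
      then obtain z where z: "z \<in> V" "?f u < ?a z" "?a z < ?f v"
        using dense_angles[OF norm[OF b] closure] by blast
      have zb: "z \<in> V - {b}" using z ab \<open>0 \<le> ?f u\<close> by auto
      have "?f (-1) < ?a z" "?a z < ?f 1" using z uv f by (meson le_less_trans less_le_trans)+
      then have "C3_sec b z = c" using cases[OF zb] c by (auto simp: algebra_simps)
      moreover have "u < C3_pos b z" "C3_pos b z < v"
        using z(2,3) \<open>C3_sec b z = c\<close> unfolding a_eq[of z] by auto
      ultimately show "\<exists>z\<in>V - {b}. C3_sec b z = c \<and> u < C3_pos b z \<and> C3_pos b z < v"
        using zb by blast
    qed
  qed
qed

theorem corollary43:
  fixes V :: "complex set"
  assumes "C3_vertex_set V"
  shows "model_complete_core V C3_edge"
proof (rule model_complete_core_if_sector_charts)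
  show "countable V" using assms by (simp add: C3_vertex_set_def)
  show "\<exists>sec pos. sector_chart V C3_edge b sec pos" if "b \<in> V" for b
    using C3_sector_chart[OF assms that] by blast
qed

end
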